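(* Let $n,q\ge 1$ and let $f:\mathbb{R}^n\to\mathbb{R}^q$ be a partially defined function with domain $\mathrm{dom}(f)\subseteq\mathbb{R}^n$. Then $f$ is definable in $\mathrm{FO}(\mathbb{R},+,\leq)$ if and only if $f$ is $\mathrm{FO}(\mathbb{R},+,\leq)$-piecewise linear.
   Context: Functions are partial: $f:X\to Y$ is defined on a set $\mathrm{dom}(f)\subseteq X$, and its graph is $G_f=\{(x,y)\in X\times Y\mid x\in\mathrm{dom}(f),\ y=f(x)\}$. The restriction of $f$ to $D\subseteq\mathrm{dom}(f)$ is denoted $f|_D$. A polyhedral convex set of $\mathbb{R}^m$ is a set of the form $C=\{c\in\mathbb{R}^m\mid \forall j\in\{1,\dots,k\}\ \sum_{i=1}^m\alpha_j[i]\,c[i]\ \#_j\ \beta_j\}$ for some finite (possibly empty) sequence of tuples $(\alpha_j,\#_j,\beta_j)\in\mathbb{Q}^m\times\{<,\leq,=,\geq,>\}\times\mathbb{Q}$. $\mathrm{FO}(\mathbb{R},+,\leq)$ is the first-order logic of the real numbers with addition and order, where rational constants are allowed in formulas (equivalently, a constant symbol for $1$ is available). A set $S\subseteq\mathbb{R}^m$ is definable in $\mathrm{FO}(\mathbb{R},+,\leq)$ if it is the set of tuples satisfying some such formula; by Fourier--Motzkin quantifier elimination, this holds if and only if $S$ is a finite union of polyhedral convex sets. A partial function $f:\mathbb{R}^n\to\mathbb{R}^q$ is definable in $\mathrm{FO}(\mathbb{R},+,\leq)$ if its graph $G_f\subseteq\mathbb{R}^{n+q}$ is. A partial function $f:\mathbb{R}^n\to\mathbb{R}^q$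 is linear (short for $\mathbb{Q}$-linear; "affine" in other terminology) if there exist a matrix $M\in\mathbb{Q}^{q\times n}$ and a vector $v\in\mathbb{Q}^q$ such that $f(a)=Ma+v$ for all $a\in\mathrm{dom}(f)$. It is $\mathrm{FO}(\mathbb{R},+,\leq)$-piecewise linear if there is a finite partition $\Pi$ of $\mathrm{dom}(f)$ such that every $X\in\Pi$ is definable in $\mathrm{FO}(\mathbb{R},+,\leq)$ and $f|_X$ is linear for every $X\in\Pi$. *)

theory Defs
  imports "HOL-Analysis.Analysis" "HOL-Library.Disjoint_Sets"
begin

section \<open>First-order logic of the reals with addition and order\<close>

datatype 'v lin_term =
    Var 'v
  | Const rat
  | Plus "'v lin_term" "'v lin_term"

datatype 'v lin_fo =
    Less_Eq "'v lin_term" "'v lin_term"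
  | Equal "'v lin_term" "'v lin_term"
  | Neg "'v lin_fo"
  | Conj "'v lin_fo" "'v lin_fo"
  | Disj "'v lin_fo" "'v lin_fo"
  | Exist 'v "'v lin_fo"
  | Forall 'v "'v lin_fo"

primrec term_val :: "('v \<Rightarrow> real) \<Rightarrow> 'v lin_term \<Rightarrow> real" where
  "term_val e (Var x) = e x"
| "term_val e (Const c) = of_rat c"
| "term_val e (Plus s t) = term_val e s + term_val e t"

primrec holds :: "('v \<Rightarrow> real) \<Rightarrow> 'v lin_fo \<Rightarrow> bool" where
  "holds e (Less_Eq s t) \<longleftrightarrow> term_val e s \<le> term_val e t"
| "holds e (Equal s t) \<longleftrightarrow> term_val e s = term_val e t"
| "holds e (Neg \<phi>) \<longleftrightarrow> \<not> holds e \<phi>"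
| "holds e (Conj \<phi> \<psi>) \<longleftrightarrow> holds e \<phi> \<and> holds e \<psi>"
| "holds e (Disj \<phi> \<psi>) \<longleftrightarrow> holds e \<phi> \<or> holds e \<psi>"
| "holds e (Exist x \<phi>) \<longleftrightarrow> (\<exists>a. holds (e(x := a)) \<phi>)"
| "holds e (Forall x \<phi>) \<longleftrightarrow> (\<forall>a. holds (e(x := a)) \<phi>)"

primrec term_vars :: "'v lin_term \<Rightarrow> 'v set" where
  "term_vars (Var x) = {x}"
| "term_vars (Const c) = {}"
| "term_vars (Plus s t) = term_vars s \<union> term_vars t"

primrec free_vars :: "'v lin_fo \<Rightarrow> 'v set" where
  "free_vars (Less_Eq s t) = term_vars s \<union> term_vars t"
| "free_vars (Equal s t) = term_vars s \<union> term_vars t"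
| "free_vars (Neg \<phi>) = free_vars \<phi>"
| "free_vars (Conj \<phi> \<psi>) = free_vars \<phi> \<union> free_vars \<psi>"
| "free_vars (Disj \<phi> \<psi>) = free_vars \<phi> \<union> free_vars \<psi>"
| "free_vars (Exist x \<phi>) = free_vars \<phi> - {x}"
| "free_vars (Forall x \<phi>) = free_vars \<phi> - {x}"

section \<open>Definable sets and functions\<close>

text \<open>The variable \<open>Inl i\<close> stands for the \<open>i\<close>-th coordinate; the variables
  \<open>Inr k\<close> are a countable supply of names for quantification and must not occur
  free, so the value \<open>0\<close> assigned to them is irrelevant.\<close>

definition definable :: "(real ^ 'm) set \<Rightarrow> bool" where
  "definable S \<longleftrightarrow> (\<exists>\<phi> :: ('m + nat) lin_fo.
     free_vars \<phi> \<subseteq> range Inl \<and>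
     S = {x. holds (case_sum (\<lambda>i. x $ i) (\<lambda>_. 0)) \<phi>})"

definition vec_join :: "real ^ 'n \<Rightarrow> real ^ 'q \<Rightarrow> real ^ ('n + 'q)" where
  "vec_join x y = (\<chi> k. case k of Inl i \<Rightarrow> x $ i | Inr j \<Rightarrow> y $ j)"

definition graph_set :: "(real ^ 'n \<rightharpoonup> real ^ 'q) \<Rightarrow> (real ^ ('n + 'q)) set" where
  "graph_set f = (\<lambda>(x, y). vec_join x y) ` Map.graph f"

definition definable_fun :: "(real ^ 'n \<rightharpoonup> real ^ 'q) \<Rightarrow> bool" where
  "definable_fun f \<longleftrightarrow> definable (graph_set f)"

section \<open>Piecewise linear functions\<close>

definition rat_linear :: "(real ^ 'n \<rightharpoonup> real ^ 'q) \<Rightarrow> bool" where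
  "rat_linear f \<longleftrightarrow> (\<exists>(M :: real ^ 'n ^ 'q) (v :: real ^ 'q).
     (\<forall>j i. M $ j $ i \<in> \<rat>) \<and> (\<forall>j. v $ j \<in> \<rat>) \<and>
     (\<forall>a \<in> dom f. f a = Some (M *v a + v)))"

definition fo_piecewise_linear :: "(real ^ 'n \<rightharpoonup> real ^ 'q) \<Rightarrow> bool" where
  "fo_piecewise_linear f \<longleftrightarrow> (\<exists>P. finite P \<and> partition_on (dom f) P \<and>
     (\<forall>X \<in> P. definable X \<and> rat_linear (f |` X)))"

end

theory Submission
  imports Defs
begin

text \<open>The proof rests on quantifier elimination by test points (Ferrante--Rackoff): the truth of a
  quantifier-free formula at \<open>x = a\<close> depends only on the position of \<open>a\<close> relative to finitely many
  rational affine functions of the other variables, so if some \<open>a\<close> is a witness, then so is one of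
  finitely many rational affine functions (the breakpoints, their midpoints, their shifts by \<open>1\<close>, and
  \<open>0\<close>). Substituting these eliminates a quantifier. Applied to the graph of \<open>f\<close>, where the witness
  is unique, the same fact says that each coordinate of \<open>f x\<close> is the value at \<open>x\<close> of one of finitely
  many rational affine functions; the sets on which \<open>f\<close> agrees with a given tuple of these cover the
  domain and only have to be made disjoint.\<close>

section \<open>Rational affine functions and semilinear predicates on environments\<close>

text \<open>Taken semantically, as functions on environments, so that substitution is composition.
  The set \<open>W\<close> bounds the variables a function may depend on and plays the part of free
  variables.\<close>

inductive rat_affine :: "'v set \<Rightarrow> (('v \<Rightarrow> real) \<Rightarrow> real) \<Rightarrow> bool" for W where
  rat_affine_var: "v \<in> W \<Longrightarrow> rat_affine W (\<lambda>e. e v)"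
| rat_affine_const: "c \<in> \<rat> \<Longrightarrow> rat_affine W (\<lambda>_. c)"
| rat_affine_add: "rat_affine W l \<Longrightarrow> rat_affine W m \<Longrightarrow> rat_affine W (\<lambda>e. l e + m e)"
| rat_affine_scale: "c \<in> \<rat> \<Longrightarrow> rat_affine W l \<Longrightarrow> rat_affine W (\<lambda>e. c * l e)"

text \<open>The semantic counterpart of quantifier-free formulas. Atoms with \<open>\<le>\<close>
  suffice, since equality is two inequalities and strict order is a negated one.\<close>

inductive semilinear :: "'v set \<Rightarrow> (('v \<Rightarrow> real) \<Rightarrow> bool) \<Rightarrow> bool" for W where
  semilinear_atom: "rat_affine W l \<Longrightarrow> semilinear W (\<lambda>e. l e \<le> 0)"
| semilinear_not: "semilinear W P \<Longrightarrow> semilinear W (\<lambda>e. \<not> P e)"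
| semilinear_conj: "semilinear W P \<Longrightarrow> semilinear W Q \<Longrightarrow> semilinear W (\<lambda>e. P e \<and> Q e)"

section \<open>Substitution and dependence on variables\<close>

lemma rat_affine_subst:
  assumes "rat_affine W l" "\<And>v. v \<in> W \<Longrightarrow> rat_affine U (\<lambda>e. \<sigma> e v)"
  shows "rat_affine U (\<lambda>e. l (\<sigma> e))"
  using assms by induction (auto intro: rat_affine.intros)

text \<open>As \<open>\<sigma>\<close> may also change the type of the variables, this one fact
  covers enlarging \<open>W\<close>, plugging in test points, and passing between coordinates and
  formula variables.\<close>

lemma semilinear_subst:
  assumes "semilinear W P" "\<And>v. v \<in> W \<Longrightarrow> rat_affine U (\<lambda>e. \<sigma> e v)"
  shows "semilinear U (\<lambda>e. P (\<sigma> e))"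
  using assms(1)
proof induction
  case (semilinear_atom l)
  show ?case
    by (rule semilinear.semilinear_atom)
      (rule rat_affine_subst[where \<sigma> = \<sigma>, OF semilinear_atom assms(2)])
next
  case (semilinear_not P)
  then show ?case by (intro semilinear.semilinear_not)
next
  case (semilinear_conj P Q)
  then show ?case by (intro semilinear.semilinear_conj)
qed

lemma rat_affine_mono: "rat_affine W l \<Longrightarrow> W \<subseteq> U \<Longrightarrow> rat_affine U l"
  by (rule rat_affine_subst[where \<sigma> = "\<lambda>e. e", simplified]) (auto simp: rat_affine_var)

lemma semilinear_mono: "semilinear W P \<Longrightarrow> W \<subseteq> U \<Longrightarrow> semilinear U P"
  by (rule semilinear_subst[where \<sigma> = "\<lambda>e. e", simplified]) (auto simp: rat_affine_var)

lemma rat_affine_cong: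
  assumes "rat_affine W l" "\<And>v. v \<in> W \<Longrightarrow> e v = e' v"
  shows "l e = l e'"
  using assms by induction auto

lemma semilinear_cong:
  assumes "semilinear W P" "\<And>v. v \<in> W \<Longrightarrow> e v = e' v"
  shows "P e \<longleftrightarrow> P e'"
  using assms(1)
  by induction (simp_all add: rat_affine_cong[of W _ e e'] assms(2))

section \<open>Closure under arithmetic, Boolean operations and finite index sets\<close>

lemma rat_affine_diff:
  assumes "rat_affine W l" "rat_affine W m"
  shows "rat_affine W (\<lambda>e. l e - m e)"
  using rat_affine_add[OF assms(1) rat_affine_scale[of "-1", OF _ assms(2)]] by simp

lemma rat_affine_sum:
  assumes "\<And>i. i \<in> I \<Longrightarrow> rat_affine W (l i)"
  shows "rat_affine W (\<lambda>e. \<Sum>i\<in>I. l i e)"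
  using assms
  by (induction I rule: infinite_finite_induct) (auto intro: rat_affine_const rat_affine_add)

lemma semilinear_disj:
  assumes "semilinear W P" "semilinear W Q"
  shows "semilinear W (\<lambda>e. P e \<or> Q e)"
  using semilinear_not[OF semilinear_conj[OF semilinear_not semilinear_not, OF assms]] by simp

lemma semilinear_le:
  assumes "rat_affine W l" "rat_affine W m"
  shows "semilinear W (\<lambda>e. l e \<le> m e)"
  using semilinear_atom[OF rat_affine_diff[OF assms]] by simp

lemma semilinear_eq:
  assumes "rat_affine W l" "rat_affine W m"
  shows "semilinear W (\<lambda>e. l e = m e)"
  using semilinear_conj[OF semilinear_le semilinear_le, OF assms assms(2,1)]
  by (simp add: order_eq_iff)

lemma semilinear_False: "semilinear W (\<lambda>_. False)"
  using semilinear_atom[OF rat_affine_const[of 1]] by simp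

lemma semilinear_Bex:
  assumes "finite I" "\<And>i. i \<in> I \<Longrightarrow> semilinear W (P i)"
  shows "semilinear W (\<lambda>e. \<exists>i\<in>I. P i e)"
  using assms by (induction I) (auto intro: semilinear_False semilinear_disj)

lemma semilinear_Ball:
  assumes "finite I" "\<And>i. i \<in> I \<Longrightarrow> semilinear W (P i)"
  shows "semilinear W (\<lambda>e. \<forall>i\<in>I. P i e)"
  using semilinear_not[OF semilinear_Bex[OF assms(1) semilinear_not[OF assms(2)]]] by simp

section \<open>Quantifier elimination by test points\<close>

text \<open>Isolates the coefficient of \<open>x\<close>: when it is nonzero, the atom changes sign
  in \<open>x\<close> only at \<open>- m e / c\<close>, which does not involve
  \<open>x\<close>.\<close>

lemma rat_affine_split:
  assumes "rat_affine W l"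
  shows "\<exists>c m. c \<in> \<rat> \<and> rat_affine (W - {x}) m \<and> (\<forall>e. l e = c * e x + m e)"
  using assms
proof induction
  case (rat_affine_var v)
  show ?case
  proof (cases "v = x")
    case True
    then show ?thesis
      by (intro exI[of _ 1] exI[of _ "\<lambda>_. 0"]) (auto intro: rat_affine.rat_affine_const)
  next
    case False
    with rat_affine_var show ?thesis
      by (intro exI[of _ 0] exI[of _ "\<lambda>e. e v"]) (auto intro: rat_affine.rat_affine_var)
  qed
next
  case (rat_affine_const c)
  then show ?case
    by (intro exI[of _ 0] exI[of _ "\<lambda>_. c"]) (auto intro: rat_affine.rat_affine_const)
next
  case (rat_affine_add l m)
  then obtain c l' d m' where *: "c \<in> \<rat>" "rat_affine (W - {x}) l'" "\<forall>e. l e = c * e x + l' e"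
    "d \<in> \<rat>" "rat_affine (W - {x}) m'" "\<forall>e. m e = d * e x + m' e"
    by blast
  then show ?case
    by (intro exI[of _ "c + d"] exI[of _ "\<lambda>e. l' e + m' e"])
      (auto intro: rat_affine.rat_affine_add simp: algebra_simps)
next
  case (rat_affine_scale a l)
  then obtain c l' where *: "c \<in> \<rat>" "rat_affine (W - {x}) l'" "\<forall>e. l e = c * e x + l' e"
    by blast
  with rat_affine_scale.hyps show ?case
    by (intro exI[of _ "a * c"] exI[of _ "\<lambda>e. a * l' e"])
      (auto intro: rat_affine.rat_affine_scale simp: algebra_simps)
qed

text \<open>An atom with nonzero coefficient of \<open>x\<close> contributes its zero, negation
  contributes nothing new, and conjunction takes the union. The two comparisons with
  \<open>t e\<close> record whether a point lies below, at or above it.\<close>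

lemma semilinear_breakpoints:
  assumes "semilinear W P"
  shows "\<exists>B. finite B \<and> (\<forall>t\<in>B. rat_affine (W - {x}) t) \<and>
    (\<forall>e a b. (\<forall>t\<in>B. (a < t e \<longleftrightarrow> b < t e) \<and> (t e < a \<longleftrightarrow> t e < b)) \<longrightarrow>
      P (e(x := a)) = P (e(x := b)))"
  using assms
proof induction
  case (semilinear_atom l)
  then obtain c m where c: "c \<in> \<rat>" and m: "rat_affine (W - {x}) m"
    and l: "\<And>e. l e = c * e x + m e"
    using rat_affine_split by metis
  have m_upd: "m (e(x := a)) = m e" for e a
    by (rule rat_affine_cong[OF m]) auto
  show ?case
  proof (cases "c = 0")
    case True
    then show ?thesis
      by (intro exI[of _ "{}"]) (auto simp: l m_upd simp del: fun_upd_apply)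
  next
    case False
    \<comment> \<open>The zero of the atom in \<open>x\<close>. In the factored form
      \<open>c * (a - t e)\<close> the sign depends only on the position of \<open>a\<close>
      relative to \<open>t e\<close>.\<close>
    define t where "t = (\<lambda>e. (- 1 / c) * m e)"
    have t: "rat_affine (W - {x}) t"
      unfolding t_def using c m by (intro rat_affine_scale) auto
    have "l (e(x := a)) = c * (a - t e)" for e a
      using False by (simp add: l m_upd t_def field_simps)
    then show ?thesis
      by (intro exI[of _ "{t}"]) (auto simp: t mult_le_0_iff not_less simp del: fun_upd_apply)
  qed
next
  case (semilinear_not P)
  then show ?case by simp
next
  case (semilinear_conj P Q)
  then obtain B C where BC: "finite B" "\<forall>t\<in>B. rat_affine (W - {x}) t"
    "\<forall>e a b. (\<forall>t\<in>B. (a < t e \<longleftrightarrow> b < t e) \<and> (t e < a \<longleftrightarrow> t e < b)) \<longrightarrow>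
      P (e(x := a)) = P (e(x := b))"
    "finite C" "\<forall>t\<in>C. rat_affine (W - {x}) t"
    "\<forall>e a b. (\<forall>t\<in>C. (a < t e \<longleftrightarrow> b < t e) \<and> (t e < a \<longleftrightarrow> t e < b)) \<longrightarrow>
      Q (e(x := a)) = Q (e(x := b))"
    by (elim exE conjE) rule
  show ?case
  proof (intro exI[of _ "B \<union> C"] conjI allI impI)
    fix e a b
    assume *: "\<forall>t\<in>B \<union> C. (a < t e \<longleftrightarrow> b < t e) \<and> (t e < a \<longleftrightarrow> t e < b)"
    have "P (e(x := a)) = P (e(x := b))"
      by (rule BC(3)[THEN spec, THEN spec, THEN spec, THEN mp]) (use * in simp)
    moreover have "Q (e(x := a)) = Q (e(x := b))"
      by (rule BC(6)[THEN spec, THEN spec, THEN spec, THEN mp]) (use * in simp)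
    ultimately show "(P (e(x := a)) \<and> Q (e(x := a))) = (P (e(x := b)) \<and> Q (e(x := b)))"
      by simp
  qed (use BC in auto)
qed

text \<open>A point of \<open>A\<close> is its own witness; outside the range of \<open>A\<close> a
  unit step beyond the extreme element works, and inside a gap the midpoint of its two ends. The
  \<open>0\<close> is there for empty \<open>A\<close>.\<close>

lemma exists_test_point:
  fixes A :: "real set"
  assumes "finite A"
  shows "\<exists>b \<in> A \<union> (\<lambda>t. t - 1) ` A \<union> (\<lambda>t. t + 1) ` A \<union> (\<lambda>(s, t). (s + t) / 2) ` (A \<times> A) \<union> {0}.
    \<forall>t\<in>A. (a < t \<longleftrightarrow> b < t) \<and> (t < a \<longleftrightarrow> t < b)"
proof -
  consider "a \<in> A" | "a \<notin> A" "\<forall>t\<in>A. a \<le> t" | "a \<notin> A" "\<forall>t\<in>A. t \<le> a"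
    | "a \<notin> A" "\<exists>t\<in>A. a < t" "\<exists>t\<in>A. t < a"
    by (meson not_less)
  then show ?thesis
  proof cases
    case 1
    then show ?thesis by blast
  next
    case 2
    then have "\<forall>t\<in>A. a < t" by (auto simp: order_less_le)
    show ?thesis
    proof (cases "A = {}")
      case False
      have "Min A - 1 < t" if "t \<in> A" for t
        using Min_le[OF assms that] by simp
      moreover have "Min A \<in> A"
        using assms False by simp
      ultimately show ?thesis
        by (intro bexI[of _ "Min A - 1"] ballI) (use \<open>\<forall>t\<in>A. a < t\<close> in \<open>auto dest: less_asym\<close>)
    qed auto
  next
    case 3
    then have "\<forall>t\<in>A. t < a" by (auto simp: order_less_le)
    show ?thesis
    proof (cases "A = {}")
      case False
      have "t < Max A + 1" if "t \<in> A" for t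
        using Max_ge[OF assms that] by simp
      moreover have "Max A \<in> A"
        using assms False by simp
      ultimately show ?thesis
        by (intro bexI[of _ "Max A + 1"] ballI) (use \<open>\<forall>t\<in>A. t < a\<close> in \<open>auto dest: less_asym\<close>)
    qed auto
  next
    case 4
    \<comment> \<open>\<open>s\<close> and \<open>u\<close> are the neighbours of \<open>a\<close>
      in \<open>A\<close>. No element of \<open>A\<close> lies strictly between them, so their
      midpoint is in the same gap as \<open>a\<close>.\<close>
    define s where "s = Max {t \<in> A. t < a}"
    define u where "u = Min {t \<in> A. a < t}"
    have "s \<in> {t \<in> A. t < a}" unfolding s_def using assms 4 by (intro Max_in) auto
    moreover have "u \<in> {t \<in> A. a < t}" unfolding u_def using assms 4 by (intro Min_in) auto
    moreover have "t \<le> s" if "t \<in> A" "t < a" for t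
      unfolding s_def using assms that by (intro Max_ge) auto
    moreover have "u \<le> t" if "t \<in> A" "a < t" for t
      unfolding u_def using assms that by (intro Min_le) auto
    ultimately have su: "s \<in> A" "u \<in> A" "s < a" "a < u"
      "\<And>t. t \<in> A \<Longrightarrow> t < a \<Longrightarrow> t \<le> s" "\<And>t. t \<in> A \<Longrightarrow> a < t \<Longrightarrow> u \<le> t"
      by auto
    have "(a < t \<longleftrightarrow> (s + u) / 2 < t) \<and> (t < a \<longleftrightarrow> t < (s + u) / 2)" if "t \<in> A" for t
    proof (cases "t < a")
      case True
      with su(5)[OF that] su(3,4) show ?thesis by (simp add: field_simps)
    next
      case False
      with that 4 have "a < t" by (metis linorder_neqE)
      with su(6)[OF that] su(3,4) show ?thesis by (simp add: field_simps)
    qed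
    with su show ?thesis
      by (intro bexI[of _ "(s + u) / 2"]) auto
  qed
qed

text \<open>Makes the test points uniform in \<open>e\<close>: a finite set of functions of the
  remaining variables, chosen before \<open>e\<close> and \<open>a\<close>. The order of the
  breakpoints varies with \<open>e\<close>, so midpoints of all pairs are included.\<close>

lemma semilinear_test_points:
  assumes "semilinear W P"
  obtains T where "finite T" "\<And>t. t \<in> T \<Longrightarrow> rat_affine (W - {x}) t"
    "\<And>e a. P (e(x := a)) \<Longrightarrow> \<exists>t\<in>T. P (e(x := t e))"
proof -
  obtain B where B: "finite B" "\<And>t. t \<in> B \<Longrightarrow> rat_affine (W - {x}) t"
    and P: "\<And>e a b. \<forall>t\<in>B. (a < t e \<longleftrightarrow> b < t e) \<and> (t e < a \<longleftrightarrow> t e < b) \<Longrightarrow>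
      P (e(x := a)) = P (e(x := b))"
    using semilinear_breakpoints[OF assms, of x] by blast
  define T where "T = B \<union> (\<lambda>t e. t e - 1) ` B \<union> (\<lambda>t e. t e + 1) ` B
    \<union> (\<lambda>(s, t) e. (1 / 2) * (s e + t e)) ` (B \<times> B) \<union> {\<lambda>_. 0}"
  show thesis
  proof
    show "finite T" using B(1) by (simp add: T_def)
    have "rat_affine (W - {x}) (\<lambda>e. t e - 1)" "rat_affine (W - {x}) (\<lambda>e. t e + 1)"
      "rat_affine (W - {x}) (\<lambda>e. (1 / 2) * (s e + t e))" "rat_affine (W - {x}) (\<lambda>_. 0)"
      if "s \<in> B" "t \<in> B" for s t
      using that
      by (intro rat_affine_const rat_affine_diff rat_affine_add rat_affine_scale B(2); simp)+
    then show "rat_affine (W - {x}) t" if "t \<in> T" for t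
      using that B(2) rat_affine_const[of 0] unfolding T_def by auto
    show "\<exists>t\<in>T. P (e(x := t e))" if "P (e(x := a))" for e a
    proof -
      let ?A = "(\<lambda>t. t e) ` B"
      obtain b where b: "b \<in> ?A \<union> (\<lambda>t. t - 1) ` ?A \<union> (\<lambda>t. t + 1) ` ?A
          \<union> (\<lambda>(s, t). (s + t) / 2) ` (?A \<times> ?A) \<union> {0}"
        "\<forall>t\<in>?A. (a < t \<longleftrightarrow> b < t) \<and> (t < a \<longleftrightarrow> t < b)"
        using exists_test_point[OF finite_imageI[OF B(1)], of "\<lambda>t. t e" a] by (rule bexE)
      from b(1) consider t where "t \<in> B" "b = t e" | t where "t \<in> B" "b = t e - 1"
        | t where "t \<in> B" "b = t e + 1" | s t where "s \<in> B" "t \<in> B" "b = (s e + t e) / 2"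
        | "b = 0"
        by auto
      \<comment> \<open>Each kind of test point for the values of \<open>B\<close> at
        \<open>e\<close> is the value at \<open>e\<close> of the matching function in
        \<open>T\<close>.\<close>
      then have "b \<in> (\<lambda>t. t e) ` T"
      proof cases
        case (2 t)
        then show ?thesis by (intro image_eqI[of _ _ "\<lambda>e. t e - 1"]) (auto simp: T_def)
      next
        case (3 t)
        then show ?thesis by (intro image_eqI[of _ _ "\<lambda>e. t e + 1"]) (auto simp: T_def)
      next
        case (4 s t)
        then show ?thesis
          by (intro image_eqI[of _ _ "\<lambda>e. (1 / 2) * (s e + t e)"]) (auto simp: T_def)
      next
        case 5
        then show ?thesis by (intro image_eqI[of _ _ "\<lambda>_. 0"]) (auto simp: T_def)
      qed (auto simp: T_def)
      moreover have "P (e(x := b))"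
        using P[of a e b] b(2) that by simp
      ultimately show ?thesis by auto
    qed
  qed
qed

text \<open>The quantifier becomes a finite disjunction over the test points, each disjunct being a
  substitution instance of \<open>P\<close> without \<open>x\<close>.\<close>

lemma semilinear_ex:
  assumes "semilinear W P"
  shows "semilinear (W - {x}) (\<lambda>e. \<exists>a. P (e(x := a)))"
proof -
  obtain T where T: "finite T" "\<And>t. t \<in> T \<Longrightarrow> rat_affine (W - {x}) t"
    "\<And>e a. P (e(x := a)) \<Longrightarrow> \<exists>t\<in>T. P (e(x := t e))"
    using semilinear_test_points[OF assms, of x] by blast
  have "semilinear (W - {x}) (\<lambda>e. \<exists>t\<in>T. P (e(x := t e)))"
    using T(1)
  proof (rule semilinear_Bex)
    show "semilinear (W - {x}) (\<lambda>e. P (e(x := t e)))" if "t \<in> T" for t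
      using assms
    proof (rule semilinear_subst)
      show "rat_affine (W - {x}) (\<lambda>e. (e(x := t e)) v)" if "v \<in> W" for v
        using that \<open>t \<in> T\<close> T(2) by (cases "v = x") (auto simp: rat_affine_var)
    qed
  qed
  also have "(\<lambda>e. \<exists>t\<in>T. P (e(x := t e))) = (\<lambda>e. \<exists>a. P (e(x := a)))"
  proof (intro ext iffI; elim exE bexE)
    show "\<exists>t\<in>T. P (e(x := t e))" if "P (e(x := a))" for e a
      using that by (rule T(3))
  qed blast
  finally show ?thesis .
qed

text \<open>Iterated elimination for a block of variables, whose new values are carried by
  \<open>e'\<close>. It serves to project a graph onto the inputs and a single output
  coordinate.\<close>

lemma semilinear_ex_finite:
  assumes "finite F" "semilinear W P"
  shows "semilinear (W - F) (\<lambda>e. \<exists>e'. (\<forall>v. v \<notin> F \<longrightarrow> e' v = e v) \<and> P e')"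
  using assms
proof (induction F)
  case empty
  have "(\<lambda>e. \<exists>e'. (\<forall>v. e' v = e v) \<and> P e') = P"
    by (simp flip: fun_eq_iff)
  with empty show ?case by simp
next
  case (insert x F)
  have "(\<lambda>e. \<exists>a e'. (\<forall>v. v \<notin> F \<longrightarrow> e' v = (e(x := a)) v) \<and> P e')
      = (\<lambda>e. \<exists>e'. (\<forall>v. v \<notin> insert x F \<longrightarrow> e' v = e v) \<and> P e')"
  proof (intro ext iffI; elim exE conjE)
    fix e e'
    assume "\<forall>v. v \<notin> insert x F \<longrightarrow> e' v = e v" "P e'"
    then show "\<exists>a e'. (\<forall>v. v \<notin> F \<longrightarrow> e' v = (e(x := a)) v) \<and> P e'"
      by (intro exI[of _ "e' x"] exI[of _ e']) auto
  next
    fix e a e'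
    assume "\<forall>v. v \<notin> F \<longrightarrow> e' v = (e(x := a)) v" "P e'"
    then show "\<exists>e'. (\<forall>v. v \<notin> insert x F \<longrightarrow> e' v = e v) \<and> P e'"
      by (intro exI[of _ e']) auto
  qed
  moreover have "W - insert x F = W - F - {x}" by auto
  ultimately show ?case
    using semilinear_ex[OF insert.IH[OF insert.prems], of x] by simp
qed

section \<open>Formulas define exactly the semilinear predicates\<close>

lemma rat_affine_term_val: "rat_affine (term_vars s) (\<lambda>e. term_val e s)"
proof (induction s)
  case (Plus s t)
  then show ?case
    using rat_affine_add[OF rat_affine_mono[OF Plus(1) Un_upper1]
        rat_affine_mono[OF Plus(2) Un_upper2]] by simp
qed (auto intro: rat_affine_var rat_affine_const)

text \<open>Quantifier elimination: both quantifiers reduce to \<open>semilinear_ex\<close>, the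
  universal one through double negation.\<close>

lemma semilinear_holds: "semilinear (free_vars \<phi>) (\<lambda>e. holds e \<phi>)"
proof (induction \<phi>)
  case (Less_Eq s t)
  then show ?case
    by (auto intro!: semilinear_le intro: rat_affine_mono[OF rat_affine_term_val])
next
  case (Equal s t)
  then show ?case
    by (auto intro!: semilinear_eq intro: rat_affine_mono[OF rat_affine_term_val])
next
  case (Forall x \<phi>)
  then show ?case
    using semilinear_not[OF semilinear_ex[OF semilinear_not[OF Forall]], of x]
    by (simp del: fun_upd_apply)
next
  case (Neg \<phi>)
  then show ?case using semilinear_not by simp
next
  case (Conj \<phi> \<psi>)
  then show ?case
    using semilinear_conj[OF semilinear_mono[OF Conj(1) Un_upper1]
        semilinear_mono[OF Conj(2) Un_upper2]] by simp
next
  case (Disj \<phi> \<psi>)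
  then show ?case
    using semilinear_disj[OF semilinear_mono[OF Disj(1) Un_upper1]
        semilinear_mono[OF Disj(2) Un_upper2]] by simp
next
  case (Exist x \<phi>)
  then show ?case using semilinear_ex by (simp del: fun_upd_apply)
qed

section \<open>From semilinear predicates back to formulas\<close>

primrec times_term :: "nat \<Rightarrow> 'v lin_term \<Rightarrow> 'v lin_term" where
  "times_term 0 s = Const 0"
| "times_term (Suc n) s = Plus s (times_term n s)"

lemma term_val_times_term [simp]: "term_val e (times_term n s) = real n * term_val e s"
  by (induction n) (auto simp: algebra_simps)

lemma term_vars_times_term: "term_vars s \<subseteq> W \<Longrightarrow> term_vars (times_term n s) \<subseteq> W"
  by (induction n) auto

text \<open>Clearing the denominator leaves an integer, which is a difference of naturals; scaling
  by \<open>c\<close> can then be expressed with \<open>times_term\<close> alone.\<close>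

lemma Rats_eq_diff_nats_divide:
  assumes "(c :: real) \<in> \<rat>"
  obtains i j k :: nat where "k > 0" "real k * c = real i - real j"
proof -
  from assms obtain p q :: int where "q > 0" "c = of_int p / of_int q"
    by (auto elim!: Rats_cases')
  then have "real (nat q) * c = real (nat p) - real (nat (- p))" "nat q > 0"
    by auto
  then show thesis using that by blast
qed

text \<open>Terms lack subtraction and multiplication by rationals, hence the difference of two terms and
  the common denominator \<open>k\<close>.\<close>

lemma rat_affine_imp_terms:
  assumes "rat_affine W l"
  shows "\<exists>k s t. 0 < (k :: nat) \<and> term_vars s \<subseteq> W \<and> term_vars t \<subseteq> W \<and>
    (\<forall>e. real k * l e = term_val e s - term_val e t)"
  using assms
proof induction
  case (rat_affine_var v)
  then show ?case
    by (intro exI[of _ 1] exI[of _ "Var v"] exI[of _ "Const 0"]) auto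
next
  case (rat_affine_const c)
  then obtain r where "c = of_rat r" by (auto elim: Rats_cases)
  then show ?case
    by (intro exI[of _ 1] exI[of _ "Const r"] exI[of _ "Const 0"]) auto
next
  case (rat_affine_add l l')
  then obtain k s t k' s' t' where
    st: "0 < k" "term_vars s \<subseteq> W" "term_vars t \<subseteq> W"
      "0 < k'" "term_vars s' \<subseteq> W" "term_vars t' \<subseteq> W"
    and l: "\<And>e. real k * l e = term_val e s - term_val e t"
    and l': "\<And>e. real k' * l' e = term_val e s' - term_val e t'"
    by metis
  \<comment> \<open>Cross-multiplication brings both summands to the common denominator
    \<open>k * k'\<close>.\<close>
  let ?s = "Plus (times_term k' s) (times_term k s')"
  let ?t = "Plus (times_term k' t) (times_term k t')"
  have "real (k * k') * (l e + l' e) = term_val e ?s - term_val e ?t" for e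
  proof -
    have "real (k * k') * (l e + l' e) = real k' * (real k * l e) + real k * (real k' * l' e)"
      by (simp add: algebra_simps)
    then show ?thesis unfolding l l' by (simp add: algebra_simps)
  qed
  moreover have "0 < k * k'" "term_vars ?s \<subseteq> W" "term_vars ?t \<subseteq> W"
    using st by (auto simp: term_vars_times_term)
  ultimately show ?case by blast
next
  case (rat_affine_scale c l)
  then obtain k s t where st: "0 < k" "term_vars s \<subseteq> W" "term_vars t \<subseteq> W"
    and l: "\<And>e. real k * l e = term_val e s - term_val e t"
    by metis
  obtain i j d where d: "d > 0" "real d * c = real i - real j"
    by (rule Rats_eq_diff_nats_divide[OF rat_affine_scale.hyps(1)])
  \<comment> \<open>The product of \<open>i - j\<close> with \<open>s - t\<close>, expanded and
    sorted by sign.\<close>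
  let ?s = "Plus (times_term i s) (times_term j t)"
  let ?t = "Plus (times_term j s) (times_term i t)"
  have "real (d * k) * (c * l e) = term_val e ?s - term_val e ?t" for e
  proof -
    have "real (d * k) * (c * l e) = (real d * c) * (real k * l e)"
      by simp
    then show ?thesis unfolding l d by (simp add: algebra_simps)
  qed
  moreover have "0 < d * k" "term_vars ?s \<subseteq> W" "term_vars ?t \<subseteq> W"
    using st d(1) by (auto simp: term_vars_times_term)
  ultimately show ?case by blast
qed

lemma semilinear_imp_holds:
  assumes "semilinear W P"
  shows "\<exists>\<phi>. free_vars \<phi> \<subseteq> W \<and> (\<forall>e. holds e \<phi> \<longleftrightarrow> P e)"
  using assms
proof induction
  case (semilinear_atom l)
  then obtain k s t where st: "0 < k" "term_vars s \<subseteq> W" "term_vars t \<subseteq> W"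
    and l: "\<And>e. real k * l e = term_val e s - term_val e t"
    using rat_affine_imp_terms by metis
  have "l e \<le> 0 \<longleftrightarrow> term_val e s \<le> term_val e t" for e
    using l[of e] st(1) mult_le_0_iff[of "real k" "l e"] by auto
  with st show ?case
    by (intro exI[of _ "Less_Eq s t"]) auto
next
  case (semilinear_not P)
  then obtain \<phi> where "free_vars \<phi> \<subseteq> W" "\<forall>e. holds e \<phi> \<longleftrightarrow> P e" by blast
  then show ?case by (intro exI[of _ "Neg \<phi>"]) auto
next
  case (semilinear_conj P Q)
  then obtain \<phi> \<psi> where "free_vars \<phi> \<subseteq> W" "\<forall>e. holds e \<phi> \<longleftrightarrow> P e"
    "free_vars \<psi> \<subseteq> W" "\<forall>e. holds e \<psi> \<longleftrightarrow> Q e" by blast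
  then show ?case by (intro exI[of _ "Conj \<phi> \<psi>"]) auto
qed

text \<open>Lets the remaining arguments work with predicates on coordinates instead of formulas.
  Both directions rename variables by substitution along \<open>Inl\<close>.\<close>

lemma definable_iff_semilinear:
  "definable S \<longleftrightarrow> (\<exists>P. semilinear UNIV P \<and> S = {x. P (($) x)})"
proof
  assume "definable S"
  then obtain \<phi> :: "('a + nat) lin_fo" where \<phi>: "free_vars \<phi> \<subseteq> range Inl"
    "S = {x. holds (case_sum (\<lambda>i. x $ i) (\<lambda>_. 0)) \<phi>}"
    unfolding definable_def by blast
  have "semilinear UNIV (\<lambda>e. holds (case_sum e (\<lambda>_. 0)) \<phi>)"
    using semilinear_mono[OF semilinear_holds \<phi>(1)]
    by (rule semilinear_subst) (auto simp: rat_affine_var)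
  with \<phi>(2) show "\<exists>P. semilinear UNIV P \<and> S = {x. P (($) x)}"
    by blast
next
  assume "\<exists>P. semilinear UNIV P \<and> S = {x. P (($) x)}"
  then obtain P where P: "semilinear UNIV P" "S = {x. P (($) x)}" by blast
  have "semilinear (range (Inl :: 'a \<Rightarrow> 'a + nat)) (\<lambda>e. P (\<lambda>i. e (Inl i)))"
    using P(1) by (rule semilinear_subst) (auto simp: rat_affine_var)
  then obtain \<phi> :: "('a + nat) lin_fo" where "free_vars \<phi> \<subseteq> range Inl"
    "\<forall>e. holds e \<phi> \<longleftrightarrow> P (\<lambda>i. e (Inl i))"
    using semilinear_imp_holds by blast
  with P(2) show "definable S"
    unfolding definable_def by (intro exI[of _ \<phi>]) auto
qed

section \<open>Boolean closure of definable sets\<close>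

lemma definable_Diff:
  assumes "definable S" "definable T"
  shows "definable (S - T)"
proof -
  obtain P Q where "semilinear UNIV P" "S = {x. P (($) x)}" "semilinear UNIV Q" "T = {x. Q (($) x)}"
    using assms unfolding definable_iff_semilinear by blast
  then show ?thesis
    unfolding definable_iff_semilinear
    by (intro exI[of _ "\<lambda>e. P e \<and> \<not> Q e"]) (auto intro!: semilinear_conj semilinear_not)
qed

lemma definable_Union:
  assumes "finite \<S>" "\<And>S. S \<in> \<S> \<Longrightarrow> definable S"
  shows "definable (\<Union>\<S>)"
proof -
  obtain P where P: "\<And>S. S \<in> \<S> \<Longrightarrow> semilinear UNIV (P S) \<and> S = {x. P S (($) x)}"
    using assms(2) unfolding definable_iff_semilinear by metis
  have "\<Union>\<S> = {x. \<exists>S\<in>\<S>. P S (($) x)}"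
    using P by blast
  with semilinear_Bex[OF assms(1), of UNIV P] P show ?thesis
    unfolding definable_iff_semilinear by blast
qed

section \<open>Definable functions\<close>

text \<open>Sets are added one at a time, each reduced by the union of those already treated;
  definability survives because differences and finite unions are definable.\<close>

lemma definable_cover_partition:
  assumes "finite \<C>" "\<And>C. C \<in> \<C> \<Longrightarrow> definable C"
  shows "\<exists>P. finite P \<and> partition_on (\<Union>\<C>) P \<and> (\<forall>X\<in>P. definable X \<and> (\<exists>C\<in>\<C>. X \<subseteq> C))"
  using assms
proof (induction \<C>)
  case empty
  then show ?case by (intro exI[of _ "{}"]) (auto simp: partition_on_def)
next
  case (insert D \<C>)
  then obtain P where P: "finite P" "partition_on (\<Union>\<C>) P"
    "\<forall>X\<in>P. definable X \<and> (\<exists>C\<in>\<C>. X \<subseteq> C)"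
    by auto
  show ?case
  \<comment> \<open>If \<open>D\<close> is already covered, its remainder is empty and may not be a
    block of a partition.\<close>
  proof (cases "D \<subseteq> \<Union>\<C>")
    case True
    then have "\<Union>(insert D \<C>) = \<Union>\<C>" by auto
    with P show ?thesis by (metis insertCI)
  next
    case False
    have "partition_on (\<Union>(insert D \<C>)) (insert (D - \<Union>\<C>) P)"
      using P(2) False unfolding partition_on_def disjoint_def by auto
    moreover have "definable (D - \<Union>\<C>)"
      using insert by (intro definable_Diff definable_Union) auto
    ultimately show ?thesis
      using P by (intro exI[of _ "insert (D - \<Union>\<C>) P"]) auto
  qed
qed

lemma vec_join_nth: "($) (vec_join x y) = case_sum (($) x) (($) y)"
  by (auto simp: vec_join_def fun_eq_iff split: sum.split)

lemma vec_join_eq_iff: "vec_join x y = vec_join x' y' \<longleftrightarrow> x = x' \<and> y = y'"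
proof
  assume "vec_join x y = vec_join x' y'"
  then have eq: "vec_join x y $ k = vec_join x' y' $ k" for k by simp
  show "x = x' \<and> y = y'"
    using eq[of "Inl i" for i] eq[of "Inr j" for j] by (simp add: vec_join_nth vec_eq_iff)
qed simp

lemma vec_join_in_graph_set: "vec_join x y \<in> graph_set f \<longleftrightarrow> f x = Some y"
  by (simp add: graph_set_def Map.graph_def vec_join_eq_iff image_iff Bex_def)

text \<open>Supplies one row of the matrix and one entry of the translation vector.\<close>

lemma rat_affine_UNIV_imp_coeffs:
  fixes l :: "('n :: finite \<Rightarrow> real) \<Rightarrow> real"
  assumes "rat_affine UNIV l"
  shows "\<exists>a c. (\<forall>i. a i \<in> \<rat>) \<and> c \<in> \<rat> \<and> (\<forall>e. l e = (\<Sum>i\<in>UNIV. a i * e i) + c)"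
  using assms
proof induction
  case (rat_affine_var v)
  have "e v = (\<Sum>i\<in>UNIV. of_bool (i = v) * e i) + 0" for e :: "'n \<Rightarrow> real"
    by (simp add: of_bool_def if_distrib[of "\<lambda>x. x * _"] cong: if_cong)
  then show ?case
    by (intro exI[of _ "\<lambda>i. of_bool (i = v)"] exI[of _ 0]) (auto simp: of_bool_def)
next
  case (rat_affine_const c)
  then show ?case by (intro exI[of _ "\<lambda>_. 0"] exI[of _ c]) auto
next
  case (rat_affine_add l m)
  then obtain a c b d where "\<forall>i. a i \<in> \<rat>" "c \<in> \<rat>" "\<forall>e. l e = (\<Sum>i\<in>UNIV. a i * e i) + c"
    "\<forall>i. b i \<in> \<rat>" "d \<in> \<rat>" "\<forall>e. m e = (\<Sum>i\<in>UNIV. b i * e i) + d"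
    by (elim exE conjE) rule
  then show ?case
    by (intro exI[of _ "\<lambda>i. a i + b i"] exI[of _ "c + d"])
      (auto simp: algebra_simps sum.distrib)
next
  case (rat_affine_scale r l)
  then obtain a c where "\<forall>i. a i \<in> \<rat>" "c \<in> \<rat>" "\<forall>e. l e = (\<Sum>i\<in>UNIV. a i * e i) + c"
    by (elim exE conjE) rule
  with rat_affine_scale.hyps show ?case
    by (intro exI[of _ "\<lambda>i. r * a i"] exI[of _ "r * c"])
      (auto simp: algebra_simps sum_distrib_left)
qed

lemma definable_fun_imp_semilinear_graph:
  assumes "definable_fun f"
  obtains Q where "semilinear UNIV Q" "\<And>x y. Q (case_sum (($) x) (($) y)) \<longleftrightarrow> f x = Some y"
proof -
  obtain Q where Q: "semilinear UNIV Q" "graph_set f = {z. Q (($) z)}"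
    using assms unfolding definable_fun_def definable_iff_semilinear by blast
  show thesis
    using that[OF Q(1)] Q(2) vec_join_in_graph_set[of _ _ f] by (simp flip: vec_join_nth)
qed

text \<open>The graph projected to the inputs and output \<open>j\<close> is again the graph of a
  function. A test point that satisfies it must therefore equal the actual value
  \<open>y $ j\<close>.\<close>

lemma definable_fun_component_candidates:
  fixes Q :: "('n :: finite + 'q :: finite \<Rightarrow> real) \<Rightarrow> bool"
  assumes Q: "semilinear UNIV Q"
    and f: "\<And>x y. Q (case_sum (($) x) (($) y)) \<longleftrightarrow> f x = Some y"
  shows "\<exists>T. finite T \<and> (\<forall>t\<in>T. rat_affine UNIV t) \<and>
    (\<forall>x y. f x = Some y \<longrightarrow> (\<exists>t\<in>T. y $ j = t (($) x)))"
proof -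
  \<comment> \<open>\<open>F\<close> holds the output coordinates other than \<open>j\<close>, and
    \<open>R\<close> projects them away.\<close>
  define F :: "('n + 'q) set" where "F = Inr ` (UNIV - {j})"
  define R where "R = (\<lambda>e. \<exists>e'. (\<forall>v. v \<notin> F \<longrightarrow> e' v = e v) \<and> Q e')"
  have "semilinear (UNIV - F) R"
    unfolding R_def by (rule semilinear_ex_finite[OF _ Q]) (simp add: F_def)
  then obtain T where T: "finite T" "\<And>t. t \<in> T \<Longrightarrow> rat_affine (UNIV - F - {Inr j}) t"
    "\<And>e a. R (e(Inr j := a)) \<Longrightarrow> \<exists>t\<in>T. R (e(Inr j := t e))"
    by (rule semilinear_test_points[where x = "Inr j"]) (rule that)
  have W: "UNIV - F - {Inr j} = range Inl"
  proof (intro set_eqI)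
    show "v \<in> UNIV - F - {Inr j} \<longleftrightarrow> v \<in> range Inl" for v
      by (cases v) (auto simp: F_def)
  qed
  \<comment> \<open>Single-valuedness enters here: whatever value \<open>R\<close> admits at
    \<open>Inr j\<close> is the \<open>j\<close>-th coordinate of \<open>f x\<close>.\<close>
  have R_D: "\<exists>z. f x = Some z \<and> z $ j = a" if "R ((case_sum (($) x) u)(Inr j := a))" for x u a
  proof -
    from that obtain e' where e': "\<And>v. v \<notin> F \<Longrightarrow> e' v = ((case_sum (($) x) u)(Inr j := a)) v" "Q e'"
      unfolding R_def by blast
    have "e' (Inl i) = x $ i" for i
      using e'(1)[of "Inl i"] by (auto simp: F_def)
    then have "case_sum (($) x) (($) (\<chi> k. e' (Inr k))) = e'"
      by (auto simp: fun_eq_iff split: sum.split)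
    with e'(2) have "f x = Some (\<chi> k. e' (Inr k))" by (simp flip: f)
    moreover have "e' (Inr j) = a" using e'(1)[of "Inr j"] by (auto simp: F_def)
    ultimately show ?thesis by auto
  qed
  have "\<exists>t\<in>T. y $ j = t (case_sum (($) x) (\<lambda>_. 0))" if "f x = Some y" for x y
  proof -
    \<comment> \<open>The \<open>0\<close> is a filler: \<open>R\<close> quantifies over the
      coordinates in \<open>F\<close>, and \<open>Inr j\<close> is overwritten.\<close>
    let ?e = "case_sum (($) x) (\<lambda>_. 0)"
    have "R (?e(Inr j := y $ j))"
      unfolding R_def using that f[of x y]
      by (intro exI[of _ "case_sum (($) x) (($) y)"]) (auto simp: F_def split: sum.split)
    with T(3) obtain t where t: "t \<in> T" "R (?e(Inr j := t ?e))" by blast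
    from R_D[OF t(2)] that have "y $ j = t ?e" by auto
    with t(1) show ?thesis by blast
  qed
  moreover have "rat_affine UNIV (\<lambda>e. t (case_sum e (\<lambda>_. 0)))" if "t \<in> T" for t
    using T(2)[OF that] unfolding W
    by (rule rat_affine_subst) (auto simp: rat_affine_var)
  ultimately show ?thesis
    using T(1) by (intro exI[of _ "(\<lambda>t e. t (case_sum e (\<lambda>_. 0))) ` T"]) auto
qed

lemma definable_fun_imp_piecewise_linear:
  fixes f :: "real ^ 'n \<rightharpoonup> real ^ 'q"
  assumes "definable_fun f"
  shows "fo_piecewise_linear f"
proof -
  obtain Q where Q: "semilinear UNIV Q"
    and f: "\<And>x y. Q (case_sum (($) x) (($) y)) \<longleftrightarrow> f x = Some y"
    using definable_fun_imp_semilinear_graph[OF assms] by blast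
  have "\<forall>j. \<exists>T. finite T \<and> (\<forall>t\<in>T. rat_affine UNIV t) \<and>
      (\<forall>x y. f x = Some y \<longrightarrow> (\<exists>t\<in>T. y $ j = t (($) x)))"
    by (intro allI definable_fun_component_candidates[OF Q f])
  from choice[OF this] obtain T where "\<forall>j. finite (T j) \<and> (\<forall>t\<in>T j. rat_affine UNIV t) \<and>
      (\<forall>x y. f x = Some y \<longrightarrow> (\<exists>t\<in>T j. y $ j = t (($) x)))"
    by (rule exE)
  then have T: "\<And>j. finite (T j)" "\<And>j t. t \<in> T j \<Longrightarrow> rat_affine UNIV t"
    "\<And>x y j. f x = Some y \<Longrightarrow> \<exists>t\<in>T j. y $ j = t (($) x)"
    by blast+
  define piece where "piece = (\<lambda>c. {x. f x = Some (\<chi> j. c j (($) x))})"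
  \<comment> \<open>One set for each choice of a candidate per output coordinate. These sets may
    overlap where candidates coincide.\<close>
  define \<C> where "\<C> = piece ` (PiE UNIV T)"
  have "finite \<C>"
    unfolding \<C>_def using T(1) by (intro finite_imageI finite_PiE) auto
  \<comment> \<open>Linearity is claimed for every subset \<open>X\<close> of a piece, since the
    blocks of the later partition are only subsets of pieces.\<close>
  have piece: "definable (piece c)" "rat_linear (f |` X)"
    if c: "c \<in> PiE UNIV T" and X: "X \<subseteq> piece c" for c X
  proof -
    have aff: "rat_affine UNIV (c j)" for j
      using c T(2) by (auto simp: PiE_def)
    \<comment> \<open>Substituting the chosen candidates for the outputs in the graph predicate
      describes the piece.\<close>
    have "semilinear UNIV (\<lambda>e. Q (case_sum e (\<lambda>j. c j e)))"
      using Q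
    proof (rule semilinear_subst)
      show "rat_affine UNIV (\<lambda>e. case_sum e (\<lambda>j. c j e) v)" for v
        by (cases v) (simp_all add: rat_affine_var aff)
    qed
    moreover have "piece c = {x. Q (case_sum (($) x) (\<lambda>j. c j (($) x)))}"
      unfolding piece_def f[symmetric] by (simp add: vec_lambda_inverse)
    ultimately show "definable (piece c)"
      unfolding definable_iff_semilinear by blast
    have "\<forall>j. \<exists>a b. (\<forall>i. a i \<in> \<rat>) \<and> b \<in> \<rat> \<and> (\<forall>e. c j e = (\<Sum>i\<in>UNIV. a i * e i) + b)"
      by (intro allI rat_affine_UNIV_imp_coeffs aff)
    then obtain a b where ab: "\<And>j i. a j i \<in> \<rat>" "\<And>j. b j \<in> \<rat>"
      "\<And>j e. c j e = (\<Sum>i\<in>UNIV. a j i * e i) + b j"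
      by metis
    have "f x = Some ((\<chi> j i. a j i) *v x + (\<chi> j. b j))" if "x \<in> X" for x
      using X that by (auto simp: piece_def ab(3) vec_eq_iff matrix_vector_mult_def)
    then show "rat_linear (f |` X)"
      unfolding rat_linear_def
      by (intro exI[of _ "\<chi> j i. a j i"] exI[of _ "\<chi> j. b j"]) (auto simp: ab)
  qed
  have "\<Union>\<C> = dom f"
  proof
    show "dom f \<subseteq> \<Union>\<C>"
    proof
      fix x
      assume "x \<in> dom f"
      then obtain y where y: "f x = Some y" by blast
      from T(3)[OF y] obtain c where "\<And>j. c j \<in> T j" "\<And>j. y $ j = c j (($) x)"
        by metis
      with y have "c \<in> PiE UNIV T" "x \<in> piece c"
        by (auto simp: piece_def vec_eq_iff)
      then show "x \<in> \<Union>\<C>" by (auto simp: \<C>_def)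
    qed
  qed (auto simp: \<C>_def piece_def)
  moreover have "definable C" if "C \<in> \<C>" for C
    using that piece(1) by (auto simp: \<C>_def)
  ultimately obtain P where P: "finite P" "partition_on (dom f) P"
    "\<And>X. X \<in> P \<Longrightarrow> definable X" "\<And>X. X \<in> P \<Longrightarrow> \<exists>C\<in>\<C>. X \<subseteq> C"
    using definable_cover_partition[OF \<open>finite \<C>\<close>] by auto
  moreover have "rat_linear (f |` X)" if "X \<in> P" for X
    using P(4)[OF that] piece(2) unfolding \<C>_def by blast
  ultimately show ?thesis
    unfolding fo_piecewise_linear_def by blast
qed

text \<open>The graph of \<open>f\<close> is the finite union of the graphs of its restrictions to
  the blocks; each of these is membership in the block together with one affine equation per output
  coordinate.\<close>

lemma piecewise_linear_imp_definable_fun: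
  fixes f :: "real ^ 'n \<rightharpoonup> real ^ 'q"
  assumes "fo_piecewise_linear f"
  shows "definable_fun f"
proof -
  obtain P where P: "finite P" "partition_on (dom f) P"
    "\<And>X. X \<in> P \<Longrightarrow> definable X" "\<And>X. X \<in> P \<Longrightarrow> rat_linear (f |` X)"
    using assms unfolding fo_piecewise_linear_def by blast
  have "definable (graph_set (f |` X))" if X: "X \<in> P" for X
  proof -
    obtain R where R: "semilinear UNIV R" "X = {x. R (($) x)}"
      using P(3)[OF X] unfolding definable_iff_semilinear by blast
    obtain M v where Mv: "\<And>j i. M $ j $ i \<in> \<rat>" "\<And>j. v $ j \<in> \<rat>"
      "\<And>a. a \<in> dom (f |` X) \<Longrightarrow> (f |` X) a = Some (M *v a + v)"
      using P(4)[OF X] unfolding rat_linear_def by blast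
    have dom: "dom (f |` X) = X"
      using P(2) X by (auto simp: partition_on_def)
    define S where "S = (\<lambda>e. R (\<lambda>i. e (Inl i)) \<and>
      (\<forall>j\<in>UNIV. e (Inr j) = (\<Sum>i\<in>UNIV. M $ j $ i * e (Inl i)) + v $ j))"
    have "semilinear UNIV (\<lambda>e. R (\<lambda>i. e (Inl i)))"
      using R(1) by (rule semilinear_subst) (auto simp: rat_affine_var)
    then have "semilinear UNIV S"
      unfolding S_def using Mv(1,2)
      by (intro semilinear_conj semilinear_Ball semilinear_eq rat_affine_add rat_affine_sum
          rat_affine_scale rat_affine_var rat_affine_const) auto
    moreover have "z \<in> graph_set (f |` X) \<longleftrightarrow> S (($) z)" for z
    proof -
      \<comment> \<open>The input and output halves of \<open>z\<close>.\<close>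
      define x y where "x = (\<chi> i. z $ Inl i)" and "y = (\<chi> j. z $ Inr j)"
      have z: "z = vec_join x y"
        by (simp add: vec_eq_iff vec_join_nth x_def y_def split: sum.split)
      have "(f |` X) x = Some y \<longleftrightarrow> x \<in> X \<and> y = M *v x + v"
        using Mv(3)[of x] dom by (auto simp: restrict_map_def)
      then show ?thesis
        unfolding z vec_join_in_graph_set
        by (auto simp: S_def R(2) vec_join_nth vec_eq_iff matrix_vector_mult_def)
    qed
    ultimately show ?thesis
      unfolding definable_iff_semilinear by blast
  qed
  then have "definable (\<Union>X\<in>P. graph_set (f |` X))"
    using P(1) by (intro definable_Union) auto
  moreover have "Map.graph f = (\<Union>X\<in>P. Map.graph (f |` X))"
  proof (intro set_eqI)
    fix z
    show "z \<in> Map.graph f \<longleftrightarrow> z \<in> (\<Union>X\<in>P. Map.graph (f |` X))"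
    proof (cases z)
      case (Pair x y)
      have "f x = Some y \<Longrightarrow> \<exists>X\<in>P. x \<in> X"
        using partition_onD1[OF P(2)] by blast
      then show ?thesis
        by (auto simp: Pair Map.graph_def restrict_map_def split: if_splits)
    qed
  qed
  ultimately show ?thesis
    by (simp add: definable_fun_def graph_set_def image_UN)
qed

theorem theorem3p4:
  fixes f :: "real ^ 'n \<rightharpoonup> real ^ 'q"
  shows "definable_fun f \<longleftrightarrow> fo_piecewise_linear f"
  using definable_fun_imp_piecewise_linear piecewise_linear_imp_definable_fun by blast

end
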